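(* Let $(X,d_\eta)$ be an $\eta$-cone metric space such that $d_\eta$ is continuous, put $D_\eta(x,y)=\|d_\eta(x,y)\|$ for $x,y\in X$, and suppose that $(X,D_\eta)$ is complete. Let $T:X\to X$ be a self mapping such that for all $x,y\in X$: $$D_\eta(Tx,Ty)\le \alpha(x,y)D_\eta(x,y)+\beta(x,y)D_\eta(x,Tx)+\gamma(x,y)D_\eta(y,Ty)+\delta(x,y)\big[D_\eta(x,Ty)+D_\eta(y,Tx)\big],$$ where $\alpha,\beta,\gamma,\delta$ are functions from $X\times X$ into $[0,1)$ such that $$\lambda=\sup\{\alpha(x,y)+\beta(x,y)+\gamma(x,y)+2\eta(x,y)\delta(x,y): x,y\in X\}<1.$$ If $\sup_{x,y\in X}\eta(x,y)<\frac1\lambda$ (where $\frac1\lambda$ is read as $+\infty$ if $\lambda=0$), then $T$ has a unique fixed point in $X$.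
   Context: Let $E$ be a real Banach space with norm $\|\cdot\|$ and zero vector $\theta$. A subset $P\subset E$ is a cone if: $P$ is closed, nonempty and $P\neq\{\theta\}$; $ax+by\in P$ for all $x,y\in P$ and all real $a,b\ge 0$; and $x\in P$, $-x\in P$ imply $x=\theta$. Write $x\preceq y$ iff $y-x\in P$, and $x\ll y$ iff $y-x\in \mathrm{Int}(P)$ (the interior of $P$). The cone $P$ is normal if there is a real $C>0$ such that $\theta\preceq x\preceq y$ implies $\|x\|\le C\|y\|$ for all $x,y\in E$; the least such positive number $K$ is the normal constant. Standing assumption: $P$ is a normal cone with normal constant $K$ and $\mathrm{Int}(P)\ne\emptyset$. Let $X$ be a nonempty set and $\eta:X\times X\to[1,\infty)$ a map. A function $d_\eta:X\times X\to E$ is an $\eta$-cone metric on $X$, and $(X,d_\eta)$ an $\eta$-cone metric space, if for all $x,y,z\in X$: (d1) $\theta\preceq d_\eta(x,y)$, and $d_\eta(x,y)=\theta$ iff $x=y$; (d2) $d_\eta(x,y)=d_\eta(y,x)$; (d3) $d_\eta(x,z)\preceq\eta(x,z)[d_\eta(x,y)+d_\eta(y,z)]$. $(X,D_\eta)$ is called the space generated by $(X,d_\eta)$. A sequence $(x_n)$ in $(X,D_\eta)$ converges to $x\in X$ if $D_\eta(x_n,x)\to0$; it is Cauchy if $D_\eta(x_n,x_m)\to0$ as $n,m\to\infty$; $(X,D_\eta)$ is complete if every Cauchy sequence converges in $X$. The natural topology on $X$ is $\mathcal T_\eta=\{U\subset X:\forall x\in U,\ \exists c\gg\theta,\ B_\eta(x,c)\subset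 U\}$, where $B_\eta(x,c)=\{y\in X: d_\eta(x,y)\ll c\}$. "$d_\eta$ is continuous" means continuous as a map $X\times X\to E$, where $X\times X$ has the product of the natural topologies and $E$ the norm topology. *)

theory Defs
  imports "HOL-Analysis.Analysis"
begin

text \<open>
  The library predicate \<^const>\<open>cone\<close> only asks for closure under nonnegative scaling; the cones used
  here are closed, convex, nontrivial and pointed.
\<close>

definition ordering_cone :: "'e::real_normed_vector set \<Rightarrow> bool" where
  "ordering_cone P \<longleftrightarrow>
     closed P \<and> P \<noteq> {} \<and> P \<noteq> {0} \<and>
     (\<forall>x\<in>P. \<forall>y\<in>P. \<forall>a b::real. 0 \<le> a \<longrightarrow> 0 \<le> b \<longrightarrow> a *\<^sub>R x + b *\<^sub>R y \<in> P) \<and>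
     (\<forall>x. x \<in> P \<longrightarrow> - x \<in> P \<longrightarrow> x = 0)"

definition cone_le :: "'e::real_normed_vector set \<Rightarrow> 'e \<Rightarrow> 'e \<Rightarrow> bool" where
  "cone_le P x y \<longleftrightarrow> y - x \<in> P"

definition cone_ll :: "'e::real_normed_vector set \<Rightarrow> 'e \<Rightarrow> 'e \<Rightarrow> bool" where
  "cone_ll P x y \<longleftrightarrow> y - x \<in> interior P"

definition normality_bound :: "'e::real_normed_vector set \<Rightarrow> real \<Rightarrow> bool" where
  "normality_bound P C \<longleftrightarrow>
     0 < C \<and> (\<forall>x y. cone_le P 0 x \<longrightarrow> cone_le P x y \<longrightarrow> norm x \<le> C * norm y)"

definition normal_cone :: "'e::real_normed_vector set \<Rightarrow> bool" where
  "normal_cone P \<longleftrightarrow> ordering_cone P \<and> (\<exists>C. normality_bound P C)"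

definition normal_constant :: "'e::real_normed_vector set \<Rightarrow> real" where
  "normal_constant P = (LEAST C. normality_bound P C)"

definition eta_cone_metric ::
  "'e::real_normed_vector set \<Rightarrow> 'a set \<Rightarrow> ('a \<Rightarrow> 'a \<Rightarrow> real) \<Rightarrow> ('a \<Rightarrow> 'a \<Rightarrow> 'e) \<Rightarrow> bool" where
  "eta_cone_metric P X \<eta> d \<longleftrightarrow>
     X \<noteq> {} \<and>
     (\<forall>x\<in>X. \<forall>y\<in>X. 1 \<le> \<eta> x y) \<and>
     (\<forall>x\<in>X. \<forall>y\<in>X. cone_le P 0 (d x y) \<and> (d x y = 0 \<longleftrightarrow> x = y)) \<and>
     (\<forall>x\<in>X. \<forall>y\<in>X. d x y = d y x) \<and>
     (\<forall>x\<in>X. \<forall>y\<in>X. \<forall>z\<in>X. cone_le P (d x z) (\<eta> x z *\<^sub>R (d x y + d y z)))"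

definition generated_dist :: "('a \<Rightarrow> 'a \<Rightarrow> 'e::real_normed_vector) \<Rightarrow> 'a \<Rightarrow> 'a \<Rightarrow> real" where
  "generated_dist d x y = norm (d x y)"

text \<open>
  The generated distance \<open>D\<close> need not satisfy the triangle inequality, so the library's metric space
  notions do not apply and convergence, Cauchy sequences and completeness are defined directly.
\<close>

definition dist_converges :: "('a \<Rightarrow> 'a \<Rightarrow> real) \<Rightarrow> (nat \<Rightarrow> 'a) \<Rightarrow> 'a \<Rightarrow> bool" where
  "dist_converges D s x \<longleftrightarrow> (\<lambda>n. D (s n) x) \<longlonglongrightarrow> 0"

definition dist_Cauchy :: "('a \<Rightarrow> 'a \<Rightarrow> real) \<Rightarrow> (nat \<Rightarrow> 'a) \<Rightarrow> bool" where
  "dist_Cauchy D s \<longleftrightarrow> ((\<lambda>(n, m). D (s n) (s m)) \<longlongrightarrow> 0) (sequentially \<times>\<^sub>F sequentially)"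

definition dist_complete :: "'a set \<Rightarrow> ('a \<Rightarrow> 'a \<Rightarrow> real) \<Rightarrow> bool" where
  "dist_complete X D \<longleftrightarrow>
     (\<forall>s. range s \<subseteq> X \<longrightarrow> dist_Cauchy D s \<longrightarrow> (\<exists>x\<in>X. dist_converges D s x))"

definition eta_ball ::
  "'e::real_normed_vector set \<Rightarrow> 'a set \<Rightarrow> ('a \<Rightarrow> 'a \<Rightarrow> 'e) \<Rightarrow> 'a \<Rightarrow> 'e \<Rightarrow> 'a set" where
  "eta_ball P X d x c = {y \<in> X. cone_ll P (d x y) c}"

definition eta_open ::
  "'e::real_normed_vector set \<Rightarrow> 'a set \<Rightarrow> ('a \<Rightarrow> 'a \<Rightarrow> 'e) \<Rightarrow> 'a set \<Rightarrow> bool" where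
  "eta_open P X d U \<longleftrightarrow> U \<subseteq> X \<and> (\<forall>x\<in>U. \<exists>c. cone_ll P 0 c \<and> eta_ball P X d x c \<subseteq> U)"

definition eta_topology ::
  "'e::real_normed_vector set \<Rightarrow> 'a set \<Rightarrow> ('a \<Rightarrow> 'a \<Rightarrow> 'e) \<Rightarrow> 'a topology" where
  "eta_topology P X d = topology (eta_open P X d)"

text \<open>
  The constructor \<^const>\<open>topology\<close> is only meaningful on families satisfying \<^const>\<open>istopology\<close>;
  the following facts show that this is the case for ordering cones with nonempty interior.
\<close>

lemma ordering_cone_combD:
  assumes "ordering_cone P" "x \<in> P" "y \<in> P" "0 \<le> a" "0 \<le> b"
  shows "a *\<^sub>R x + b *\<^sub>R y \<in> P"
  using assms unfolding ordering_cone_def by blast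

lemma cone_add_interior:
  assumes "ordering_cone P" "p \<in> P" "q \<in> interior P"
  shows "p + q \<in> interior P"
proof -
  have "(\<lambda>x. p + x) ` interior P \<subseteq> P"
  proof clarify
    fix x assume "x \<in> interior P"
    then have "x \<in> P" using interior_subset by blast
    then have "(1::real) *\<^sub>R p + (1::real) *\<^sub>R x \<in> P"
      by (intro ordering_cone_combD[OF assms(1)]) (use assms(2) in auto)
    then show "p + x \<in> P" by simp
  qed
  moreover have "open ((\<lambda>x. p + x) ` interior P)"
    by (simp add: open_translation)
  ultimately have "(\<lambda>x. p + x) ` interior P \<subseteq> interior P"
    by (simp add: interior_maximal)
  then show ?thesis using assms(3) by blast
qed

lemma cone_ll_lower_bound:
  assumes P: "ordering_cone P" and a: "a \<in> interior P" and b: "b \<in> interior P"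
  obtains c where "c \<in> interior P" "a - c \<in> P" "b - c \<in> P"
proof -
  have lim: "(\<lambda>n. x - inverse (real (Suc n)) *\<^sub>R a) \<longlonglongrightarrow> x" for x
    using tendsto_diff[OF tendsto_const tendsto_scaleR[OF LIMSEQ_inverse_real_of_nat tendsto_const[of a]], of x]
    by simp
  have "eventually (\<lambda>n. x - inverse (real (Suc n)) *\<^sub>R a \<in> interior P) sequentially"
    if "x \<in> interior P" for x
    using topological_tendstoD[OF lim open_interior that] .
  from eventually_conj[OF this[OF a] this[OF b]]
  obtain n where n: "a - inverse (real (Suc n)) *\<^sub>R a \<in> interior P"
    "b - inverse (real (Suc n)) *\<^sub>R a \<in> interior P"
    by (auto simp: eventually_sequentially)
  let ?t = "inverse (real (Suc n))"
  have t: "?t > 0" by simp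
  have "(\<lambda>x. ?t *\<^sub>R x) ` interior P \<subseteq> P"
  proof clarify
    fix x assume "x \<in> interior P"
    then have "x \<in> P" using interior_subset by blast
    then have "?t *\<^sub>R x + (0::real) *\<^sub>R x \<in> P"
      by (intro ordering_cone_combD[OF P]) (use t in auto)
    then show "?t *\<^sub>R x \<in> P" by simp
  qed
  moreover have "open ((\<lambda>x. ?t *\<^sub>R x) ` interior P)"
    using t by (intro open_scaling) auto
  ultimately have "(\<lambda>x. ?t *\<^sub>R x) ` interior P \<subseteq> interior P"
    by (simp add: interior_maximal)
  then have "?t *\<^sub>R a \<in> interior P" using a by blast
  then show thesis using n interior_subset that by blast
qed

lemma eta_ball_mono:
  assumes "ordering_cone P" "c' - c \<in> P"
  shows "eta_ball P X d x c \<subseteq> eta_ball P X d x c'"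
proof
  fix y assume "y \<in> eta_ball P X d x c"
  then have y: "y \<in> X" "c - d x y \<in> interior P" by (simp_all add: eta_ball_def cone_ll_def)
  have "(c' - c) + (c - d x y) \<in> interior P"
    by (rule cone_add_interior[OF assms y(2)])
  then show "y \<in> eta_ball P X d x c'"
    using y(1) by (simp add: eta_ball_def cone_ll_def)
qed

lemma istopology_eta_open:
  assumes P: "ordering_cone P"
  shows "istopology (eta_open P X d)"
  unfolding istopology_def
proof (intro conjI allI impI)
  fix S T assume S: "eta_open P X d S" and T: "eta_open P X d T"
  show "eta_open P X d (S \<inter> T)"
    unfolding eta_open_def
  proof (intro conjI ballI)
    show "S \<inter> T \<subseteq> X" using S by (auto simp: eta_open_def)
    fix x assume x: "x \<in> S \<inter> T"
    obtain a where a: "a \<in> interior P" "eta_ball P X d x a \<subseteq> S"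
      using S x unfolding eta_open_def cone_ll_def diff_zero by blast
    obtain b where b: "b \<in> interior P" "eta_ball P X d x b \<subseteq> T"
      using T x unfolding eta_open_def cone_ll_def diff_zero by blast
    obtain c where c: "c \<in> interior P" "a - c \<in> P" "b - c \<in> P"
      using cone_ll_lower_bound[OF P a(1) b(1)] .
    have "eta_ball P X d x c \<subseteq> S \<inter> T"
      by (rule Int_greatest; rule subset_trans)
        (rule eta_ball_mono[OF P c(2)] a(2) eta_ball_mono[OF P c(3)] b(2))+
    then show "\<exists>c. cone_ll P 0 c \<and> eta_ball P X d x c \<subseteq> S \<inter> T"
      using c(1) by (auto simp: cone_ll_def)
  qed
next
  fix \<K> assume K: "\<forall>U\<in>\<K>. eta_open P X d U"
  show "eta_open P X d (\<Union>\<K>)"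
    unfolding eta_open_def
  proof (intro conjI ballI)
    show "\<Union>\<K> \<subseteq> X"
      by (rule Sup_least) (use K in \<open>simp add: eta_open_def\<close>)
    fix x assume "x \<in> \<Union>\<K>"
    then obtain U where U: "U \<in> \<K>" "x \<in> U" by blast
    have "eta_open P X d U" using K U(1) by (rule bspec)
    then have "\<exists>c. cone_ll P 0 c \<and> eta_ball P X d x c \<subseteq> U"
      using U(2) by (simp add: eta_open_def)
    then obtain c where c: "cone_ll P 0 c" "eta_ball P X d x c \<subseteq> U" by (elim exE conjE)
    have "eta_ball P X d x c \<subseteq> \<Union>\<K>"
      using c(2) Union_upper[OF U(1)] by (rule subset_trans)
    with c(1) show "\<exists>c. cone_ll P 0 c \<and> eta_ball P X d x c \<subseteq> \<Union>\<K>"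
      by (intro exI conjI)
  qed
qed

lemma openin_eta_topology:
  assumes "ordering_cone P"
  shows "openin (eta_topology P X d) U \<longleftrightarrow> eta_open P X d U"
  by (simp add: eta_topology_def topology_inverse'[OF istopology_eta_open[OF assms]])

lemma topspace_eta_topology:
  assumes P: "ordering_cone P" and "interior P \<noteq> {}"
  shows "topspace (eta_topology P X d) = X"
proof
  show "topspace (eta_topology P X d) \<subseteq> X"
    using openin_topspace[of "eta_topology P X d"]
    by (simp only: openin_eta_topology[OF P] eta_open_def)
  have "eta_open P X d X"
    using assms(2) unfolding eta_open_def by (auto simp: cone_ll_def eta_ball_def)
  then show "X \<subseteq> topspace (eta_topology P X d)"
    by (simp add: openin_subset openin_eta_topology[OF P])
qed

definition eta_continuous ::
  "'e::real_normed_vector set \<Rightarrow> 'a set \<Rightarrow> ('a \<Rightarrow> 'a \<Rightarrow> 'e) \<Rightarrow> bool" where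
  "eta_continuous P X d \<longleftrightarrow>
     continuous_map (prod_topology (eta_topology P X d) (eta_topology P X d)) euclidean
       (\<lambda>(x, y). d x y)"

end

theory Submission
  imports Defs
begin

text \<open>
  The map is a quasi-contraction in the sense of Ciric: since \<open>\<eta> \<ge> 1\<close>, the right-hand side of the
  hypothesis is at most \<open>\<lambda>\<close> times the largest of the five distances \<open>D x y\<close>, \<open>D x (T x)\<close>,
  \<open>D y (T y)\<close>, \<open>D x (T y)\<close> and \<open>D y (T x)\<close>.  Bounding \<open>D x (T y)\<close> and \<open>D y (T x)\<close> through
  intermediate points instead would multiply \<open>\<delta>\<close> by the normal constant of the cone, which
  may be large; the quasi-contraction keeps the factor \<open>\<lambda>\<close>.

  Along an orbit \<open>x\<^sub>0, x\<^sub>1, \<dots>\<close>, the five distances that bound \<open>D x\<^sub>i\<^sub>+\<^sub>1 x\<^sub>j\<^sub>+\<^sub>1\<close> are again between points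
  of the orbit with indices up to \<open>max i j + 1\<close>.  Hence the segment from \<open>x\<^sub>p\<close> to \<open>x\<^sub>n\<close> has diameter at most \<open>\<lambda>\<^sup>p\<close>
  times that of the segment from \<open>x\<^sub>0\<close> to \<open>x\<^sub>n\<close> (\<open>quasi_contraction_decay\<close>).  Normality and
  boundedness of \<open>\<eta>\<close> give \<open>D x z \<le> c (D x y + D y z)\<close> with some constant \<open>c\<close>, usually large.
  The crucial point is that one may compare with \<open>x\<^sub>p\<close> for a fixed \<open>p\<close> with \<open>c \<lambda>\<^sup>p < 1\<close>, rather than with
  \<open>x\<^sub>1\<close>, since \<open>c \<lambda>\<close> may well exceed 1: this bounds the diameters of all segments at once
  (\<open>quasi_contraction_bounded\<close>).  The tails of a bounded orbit have geometrically decreasing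
  diameters, so the orbit is Cauchy.

  Convergence for \<open>D\<close> implies convergence in the natural topology, so continuity of \<open>d\<close> allows
  passing to the limit in the quasi-contraction inequality for \<open>x\<^sub>n\<close> and the limit \<open>x\<close>; this
  gives \<open>D x (T x) \<le> \<lambda> D x (T x)\<close>, that is, \<open>T x = x\<close>.  The same inequality for two fixed points
  shows uniqueness.
\<close>

section \<open>Orbits of quasi-contractions\<close>

text \<open>
  The number \<open>q i j\<close> stands for the distance between the \<open>i\<close>-th and the \<open>j\<close>-th point of an orbit.
  The induction is on \<open>p\<close>: each application of the contraction raises both indices by one and
  never leaves the segment up to \<open>n\<close>.
\<close>

lemma quasi_contraction_decay:
  fixes q :: "nat \<Rightarrow> nat \<Rightarrow> real"
  assumes contr: "\<And>i j M. \<lbrakk>q i j \<le> M; q i (Suc i) \<le> M; q j (Suc j) \<le> M; q i (Suc j) \<le> M;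
      q j (Suc i) \<le> M\<rbrakk> \<Longrightarrow> q (Suc i) (Suc j) \<le> l * M"
    and M: "\<And>i j. \<lbrakk>i \<le> n; j \<le> n\<rbrakk> \<Longrightarrow> q i j \<le> M"
    and "p \<le> i" "i \<le> n" "p \<le> j" "j \<le> n"
  shows "q i j \<le> l ^ p * M"
  using assms(3-)
proof (induction p arbitrary: i j)
  case 0
  then show ?case using M by simp
next
  case (Suc p)
  obtain i' j' where ij: "i = Suc i'" "j = Suc j'"
    using Suc.prems by (metis Suc_le_D)
  have "q (Suc i') (Suc j') \<le> l * (l ^ p * M)"
    by (rule contr) (use Suc.prems in \<open>auto simp: ij intro!: Suc.IH\<close>)
  then show ?case by (simp add: ij mult.assoc)
qed

text \<open>
  Let \<open>M\<close> be the diameter of the segment up to \<open>n\<close>, and fix \<open>p\<close> with \<open>c l\<^sup>p < 1\<close>.  Two points with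
  indices at least \<open>p\<close> are within \<open>l\<^sup>p M\<close>, two points with indices at most \<open>p\<close> are within a constant
  \<open>A\<close>, and the mixed case is reduced to these through the \<open>p\<close>-th point.  The resulting
  inequality \<open>M \<le> (1 + c) A + c l\<^sup>p M\<close> bounds \<open>M\<close> independently of \<open>n\<close>.
\<close>

lemma quasi_contraction_bounded:
  fixes q :: "nat \<Rightarrow> nat \<Rightarrow> real"
  assumes nonneg: "\<And>i j. 0 \<le> q i j" and sym: "\<And>i j. q i j = q j i"
    and triangle: "\<And>i j k. q i k \<le> c * (q i j + q j k)"
    and c: "1 \<le> c" and l: "0 \<le> l" "l < 1"
    and contr: "\<And>i j M. \<lbrakk>q i j \<le> M; q i (Suc i) \<le> M; q j (Suc j) \<le> M; q i (Suc j) \<le> M;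
      q j (Suc i) \<le> M\<rbrakk> \<Longrightarrow> q (Suc i) (Suc j) \<le> l * M"
  obtains B where "\<And>i j. q i j \<le> B"
proof -
  obtain p where "l ^ p < 1 / c"
    using real_arch_pow_inv[of "1 / c" l] c l by auto
  then have p: "c * l ^ p < 1" using c by (simp add: field_simps)
  define diam where "diam n = Max ((\<lambda>(i, j). q i j) ` ({..n} \<times> {..n}))" for n
  have le_diam: "q i j \<le> diam n" if "i \<le> n" "j \<le> n" for i j n
    unfolding diam_def using that by (intro Max_ge) auto
  have diam_nonneg: "0 \<le> diam n" for n
    using nonneg[of 0 0] le_diam[of 0 n 0] by simp
  have bound: "diam n \<le> c * diam p / (1 - c * l ^ p)" for n
  proof -
    let ?R = "c * (diam p + l ^ p * diam n)"
    have tail: "q i j \<le> l ^ p * diam n" if "p \<le> i" "i \<le> n" "p \<le> j" "j \<le> n" for i j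
      by (rule quasi_contraction_decay[of q l n "diam n" p i j, OF contr le_diam]) (use that in auto)
    have mixed: "q i j \<le> ?R" if "i \<le> p" "p \<le> j" "j \<le> n" for i j
    proof -
      have "q i j \<le> c * (q i p + q p j)" by (rule triangle)
      also have "\<dots> \<le> ?R"
        using c that by (intro mult_left_mono add_mono le_diam tail) auto
      finally show ?thesis .
    qed
    have nn: "0 \<le> l ^ p * diam n" using l diam_nonneg by simp
    have sum_le: "diam p + l ^ p * diam n \<le> ?R"
      using mult_right_mono[OF c, of "diam p + l ^ p * diam n"] nn diam_nonneg[of p] by simp
    have "q i j \<le> ?R" if "i \<le> n" "j \<le> n" for i j
    proof -
      consider "i \<le> p" "j \<le> p" | "i \<le> p" "p \<le> j" | "p \<le> i" "j \<le> p" | "p \<le> i" "p \<le> j"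
        by linarith
      then show ?thesis
      proof cases
        case 1
        then show ?thesis using le_diam[of i p j] nn sum_le by linarith
      next
        case 2
        then show ?thesis using mixed that by blast
      next
        case 3
        then show ?thesis using mixed[of j i] sym[of i j] that by simp
      next
        case 4
        then show ?thesis using tail[of i j] that sum_le diam_nonneg[of p] by linarith
      qed
    qed
    then have "diam n \<le> ?R"
      unfolding diam_def[of n] by (subst Max_le_iff) auto
    then have "diam n * (1 - c * l ^ p) \<le> c * diam p" by (simp add: algebra_simps)
    then show ?thesis using p by (simp add: pos_le_divide_eq)
  qed
  show thesis
  proof (rule that)
    fix i j :: nat
    show "q i j \<le> c * diam p / (1 - c * l ^ p)"
      using le_diam[of i "max i j" j] bound[of "max i j"] by simp
  qed
qed

lemma quasi_contraction_geometric_decay: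
  fixes q :: "nat \<Rightarrow> nat \<Rightarrow> real"
  assumes nonneg: "\<And>i j. 0 \<le> q i j" and sym: "\<And>i j. q i j = q j i"
    and triangle: "\<And>i j k. q i k \<le> c * (q i j + q j k)"
    and c: "1 \<le> c" and l: "0 \<le> l" "l < 1"
    and contr: "\<And>i j M. \<lbrakk>q i j \<le> M; q i (Suc i) \<le> M; q j (Suc j) \<le> M; q i (Suc j) \<le> M;
      q j (Suc i) \<le> M\<rbrakk> \<Longrightarrow> q (Suc i) (Suc j) \<le> l * M"
  obtains B where "\<And>p i j. \<lbrakk>p \<le> i; p \<le> j\<rbrakk> \<Longrightarrow> q i j \<le> l ^ p * B"
proof -
  obtain B where B: "\<And>i j. q i j \<le> B"
    by (rule quasi_contraction_bounded[of q c l, OF nonneg sym triangle c l contr]) blast+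
  have "q i j \<le> l ^ p * B" if "p \<le> i" "p \<le> j" for p i j
    by (rule quasi_contraction_decay[of q l "max i j" B p i j, OF contr B]) (use that in auto)
  then show thesis by (rule that)
qed

lemma dist_Cauchy_geometricI:
  fixes D :: "'a \<Rightarrow> 'a \<Rightarrow> real"
  assumes nonneg: "\<And>i j. 0 \<le> D (s i) (s j)" and l: "0 \<le> l" "l < 1"
    and decay: "\<And>p i j. \<lbrakk>p \<le> i; p \<le> j\<rbrakk> \<Longrightarrow> D (s i) (s j) \<le> l ^ p * B"
  shows "dist_Cauchy D s"
  unfolding dist_Cauchy_def
proof (rule tendstoI)
  fix e :: real assume "0 < e"
  have "(\<lambda>p. l ^ p * B) \<longlonglongrightarrow> 0"
    using tendsto_mult_right[OF LIMSEQ_power_zero[of l], of B] l by simp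
  then have "\<forall>\<^sub>F p in sequentially. l ^ p * B < e"
    using \<open>0 < e\<close> by (rule order_tendstoD)
  then obtain p where p: "l ^ p * B < e"
    by (auto simp: eventually_sequentially)
  have "\<forall>i\<ge>p. \<forall>j\<ge>p. D (s i) (s j) < e"
    using decay p by (meson order.strict_trans1)
  then show "\<forall>\<^sub>F x in sequentially \<times>\<^sub>F sequentially. dist (case x of (n, m) \<Rightarrow> D (s n) (s m)) 0 < e"
    unfolding eventually_prod_sequentially by (auto simp: nonneg)
qed

section \<open>The distance generated by a cone metric\<close>

lemma eta_cone_metricD:
  assumes "eta_cone_metric P X \<eta> d" "x \<in> X" "y \<in> X"
  shows "1 \<le> \<eta> x y" and "cone_le P 0 (d x y)" and "d x y = 0 \<longleftrightarrow> x = y" and "d x y = d y x"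
    and "z \<in> X \<Longrightarrow> cone_le P (d x z) (\<eta> x z *\<^sub>R (d x y + d y z))"
proof -
  note m = assms(1)[unfolded eta_cone_metric_def, THEN conjunct2]
  show "1 \<le> \<eta> x y"
    using m[THEN conjunct1] assms(2,3) by blast
  show "cone_le P 0 (d x y)" and "d x y = 0 \<longleftrightarrow> x = y"
    using m[THEN conjunct2, THEN conjunct1] assms(2,3) by blast+
  show "d x y = d y x"
    using m[THEN conjunct2, THEN conjunct2, THEN conjunct1] assms(2,3) by blast
  show "cone_le P (d x z) (\<eta> x z *\<^sub>R (d x y + d y z))" if "z \<in> X"
    using m[THEN conjunct2, THEN conjunct2, THEN conjunct2] assms(2,3) that by blast
qed

lemma generated_dist_nonneg: "0 \<le> generated_dist d x y"
  by (simp add: generated_dist_def)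

lemma generated_dist_sym:
  assumes "eta_cone_metric P X \<eta> d" "x \<in> X" "y \<in> X"
  shows "generated_dist d x y = generated_dist d y x"
  by (simp add: generated_dist_def eta_cone_metricD(4)[OF assms])

lemma generated_dist_eq_0_iff:
  assumes "eta_cone_metric P X \<eta> d" "x \<in> X" "y \<in> X"
  shows "generated_dist d x y = 0 \<longleftrightarrow> x = y"
  by (simp add: generated_dist_def eta_cone_metricD(3)[OF assms])

text \<open>The maximum with 1 gives the constant the lower bound asked for by the orbit estimates.\<close>

lemma generated_dist_triangle:
  assumes metric: "eta_cone_metric P X \<eta> d" and C: "normality_bound P C"
    and \<eta>: "\<And>x y. \<lbrakk>x \<in> X; y \<in> X\<rbrakk> \<Longrightarrow> \<eta> x y \<le> S"
    and xyz: "x \<in> X" "y \<in> X" "z \<in> X"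
  shows "generated_dist d x z \<le> max 1 (C * S) * (generated_dist d x y + generated_dist d y z)"
proof -
  have "norm (d x z) \<le> C * norm (\<eta> x z *\<^sub>R (d x y + d y z))"
    using C eta_cone_metricD(2)[OF metric xyz(1,3)] eta_cone_metricD(5)[OF metric xyz]
    unfolding normality_bound_def by blast
  moreover have "0 < C" using C by (simp add: normality_bound_def)
  moreover have "0 \<le> \<eta> x z"
    using eta_cone_metricD(1)[OF metric xyz(1,3)] by simp
  ultimately have "norm (d x z) \<le> (C * \<eta> x z) * norm (d x y + d y z)"
    by (simp add: mult.assoc)
  also have "\<dots> \<le> max 1 (C * S) * (norm (d x y) + norm (d y z))"
  proof (intro mult_mono norm_triangle_ineq)
    show "C * \<eta> x z \<le> max 1 (C * S)"
      using \<eta>[OF xyz(1,3)] \<open>0 < C\<close> by (simp add: le_max_iff_disj)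
  qed auto
  finally show ?thesis by (simp add: generated_dist_def)
qed

text \<open>
  If the norms of \<open>d (s n) x\<close> tend to 0, then \<open>c - d x (s n)\<close> tends to \<open>c\<close> and therefore
  lies eventually in the open set \<open>interior P\<close>, for every \<open>c\<close> in it.
\<close>

lemma dist_converges_imp_limitin:
  assumes P: "ordering_cone P" "interior P \<noteq> {}" and metric: "eta_cone_metric P X \<eta> d"
    and s: "range s \<subseteq> X" and x: "x \<in> X" and lim: "dist_converges (generated_dist d) s x"
  shows "limitin (eta_topology P X d) s x sequentially"
  unfolding limitin_def
proof (intro conjI allI impI)
  show "x \<in> topspace (eta_topology P X d)"
    using x by (simp add: topspace_eta_topology[OF P])
  fix U assume "openin (eta_topology P X d) U \<and> x \<in> U"
  then obtain c where c: "c \<in> interior P" "eta_ball P X d x c \<subseteq> U"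
    unfolding openin_eta_topology[OF P(1)] eta_open_def cone_ll_def diff_zero by blast
  have "(\<lambda>n. d (s n) x) \<longlonglongrightarrow> 0"
    using lim by (simp add: dist_converges_def generated_dist_def tendsto_norm_zero_iff)
  then have "(\<lambda>n. c - d (s n) x) \<longlonglongrightarrow> c - 0"
    by (intro tendsto_diff tendsto_const)
  moreover have "d (s n) x = d x (s n)" for n
    by (rule eta_cone_metricD(4)[OF metric]) (use s x in auto)
  ultimately have "(\<lambda>n. c - d x (s n)) \<longlonglongrightarrow> c" by simp
  then have "\<forall>\<^sub>F n in sequentially. c - d x (s n) \<in> interior P"
    using c(1) by (rule topological_tendstoD[OF _ open_interior])
  then show "\<forall>\<^sub>F n in sequentially. s n \<in> U"
  proof (rule eventually_mono)
    fix n assume "c - d x (s n) \<in> interior P"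
    then have "s n \<in> eta_ball P X d x c"
      using s by (simp add: eta_ball_def cone_ll_def range_subsetD)
    then show "s n \<in> U" using c(2) by blast
  qed
qed

lemma eta_continuous_dist_converges:
  assumes P: "ordering_cone P" "interior P \<noteq> {}" and metric: "eta_cone_metric P X \<eta> d"
    and cont: "eta_continuous P X d"
    and s: "range s \<subseteq> X" and x: "x \<in> X" and y: "y \<in> X"
    and lim: "dist_converges (generated_dist d) s x"
  shows "(\<lambda>n. generated_dist d (s n) y) \<longlonglongrightarrow> generated_dist d x y"
proof -
  let ?T = "eta_topology P X d"
  have "limitin ?T s x sequentially"
    by (rule dist_converges_imp_limitin[OF P metric s x lim])
  moreover have "limitin ?T (\<lambda>n. y) y sequentially"
    using y by (simp add: topspace_eta_topology[OF P])
  ultimately have "limitin (prod_topology ?T ?T) (\<lambda>n. (s n, y)) (x, y) sequentially"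
    by (simp add: limitin_pairwise o_def)
  then have "limitin euclidean ((\<lambda>(x, y). d x y) \<circ> (\<lambda>n. (s n, y))) (d x y) sequentially"
    using continuous_map_limit[OF cont[unfolded eta_continuous_def]] by fastforce
  then show ?thesis
    by (simp add: generated_dist_def o_def tendsto_norm)
qed

section \<open>The fixed point theorem\<close>

text \<open>
  Nonnegativity of \<open>M\<close> is needed because the coefficients may add up to less than \<open>l\<close>; the
  hypothesis \<open>1 \<le> h\<close> lets \<open>2 h \<delta>\<close> absorb the two terms with coefficient \<open>\<delta>\<close>.
\<close>

lemma weighted_distances_le:
  fixes a b g e h l M :: real
  assumes "0 \<le> a" "0 \<le> b" "0 \<le> g" "0 \<le> e" "1 \<le> h" "0 \<le> M"
    and "a + b + g + 2 * h * e \<le> l"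
    and "t1 \<le> M" "t2 \<le> M" "t3 \<le> M" "t4 \<le> M" "t5 \<le> M"
  shows "a * t1 + b * t2 + g * t3 + e * (t4 + t5) \<le> l * M"
proof -
  have "a * t1 + b * t2 + g * t3 + e * (t4 + t5) \<le> a * M + b * M + g * M + e * (M + M)"
    using assms by (intro add_mono mult_left_mono) auto
  also have "\<dots> = (a + b + g + 2 * 1 * e) * M" by (simp add: algebra_simps)
  also have "\<dots> \<le> l * M"
  proof (rule mult_right_mono)
    have "1 * e \<le> h * e" using assms by (intro mult_right_mono) auto
    then show "a + b + g + 2 * 1 * e \<le> l" using assms by simp
  qed (fact assms)
  finally show ?thesis .
qed

theorem quasi_contraction_unique_fixed_point:
  fixes P :: "'e::real_normed_vector set" and d :: "'a \<Rightarrow> 'a \<Rightarrow> 'e"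
  defines "D \<equiv> generated_dist d"
  assumes P: "normal_cone P" "interior P \<noteq> {}" and metric: "eta_cone_metric P X \<eta> d"
    and cont: "eta_continuous P X d" and complete: "dist_complete X D"
    and T: "T \<in> X \<rightarrow> X"
    and \<eta>: "\<And>x y. \<lbrakk>x \<in> X; y \<in> X\<rbrakk> \<Longrightarrow> \<eta> x y \<le> S"
    and l: "0 \<le> l" "l < 1"
    and contr: "\<And>x y M. \<lbrakk>x \<in> X; y \<in> X; D x y \<le> M; D x (T x) \<le> M; D y (T y) \<le> M;
      D x (T y) \<le> M; D y (T x) \<le> M\<rbrakk> \<Longrightarrow> D (T x) (T y) \<le> l * M"
  shows "\<exists>!x. x \<in> X \<and> T x = x"
proof -
  have cone: "ordering_cone P" using P(1) by (simp add: normal_cone_def)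
  obtain C where C: "normality_bound P C" using P(1) by (auto simp: normal_cone_def)
  have D_nonneg: "0 \<le> D x y" for x y by (simp add: D_def generated_dist_nonneg)
  have D_sym: "D x y = D y x" if "x \<in> X" "y \<in> X" for x y
    unfolding D_def by (rule generated_dist_sym[OF metric that])
  have D_zero: "D x y = 0 \<longleftrightarrow> x = y" if "x \<in> X" "y \<in> X" for x y
    unfolding D_def by (rule generated_dist_eq_0_iff[OF metric that])
  have D_zeroI: "x = y" if "x \<in> X" "y \<in> X" "D x y \<le> l * D x y" for x y
  proof -
    have "(1 - l) * D x y \<le> 0" using that(3) by (simp add: algebra_simps)
    then have "D x y \<le> 0" using l by (simp add: mult_le_0_iff)
    then have "D x y = 0" using D_nonneg[of x y] by simp
    then show ?thesis using D_zero that by blast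
  qed
  obtain x0 where x0: "x0 \<in> X" using metric unfolding eta_cone_metric_def by (elim conjE) blast
  define s where "s n = (T ^^ n) x0" for n
  have sX: "s n \<in> X" for n
    by (induction n) (use x0 T in \<open>auto simp: s_def\<close>)
  have s_Suc: "s (Suc n) = T (s n)" for n by (simp add: s_def)
  obtain B where B: "\<And>p i j. \<lbrakk>p \<le> i; p \<le> j\<rbrakk> \<Longrightarrow> D (s i) (s j) \<le> l ^ p * B"
  proof (rule quasi_contraction_geometric_decay[of "\<lambda>i j. D (s i) (s j)" "max 1 (C * S)" l])
    show "D (s i) (s k) \<le> max 1 (C * S) * (D (s i) (s j) + D (s j) (s k))" for i j k
      unfolding D_def by (rule generated_dist_triangle[OF metric C \<eta>]) (simp_all add: sX)
    show "D (s (Suc i)) (s (Suc j)) \<le> l * M"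
      if "D (s i) (s j) \<le> M" "D (s i) (s (Suc i)) \<le> M" "D (s j) (s (Suc j)) \<le> M"
        "D (s i) (s (Suc j)) \<le> M" "D (s j) (s (Suc i)) \<le> M" for i j M
      using that unfolding s_Suc by (intro contr sX)
  qed (use l D_nonneg D_sym sX in auto)
  have "dist_Cauchy D s"
    by (rule dist_Cauchy_geometricI[of D s l B, OF D_nonneg l B])
  then obtain x where x: "x \<in> X" and lim: "dist_converges D s x"
    using complete sX unfolding dist_complete_def by blast
  have Tx: "T x \<in> X" using T x by blast
  have lim_x: "(\<lambda>n. D (s n) x) \<longlonglongrightarrow> 0" using lim by (simp add: dist_converges_def)
  have lim_Tx: "(\<lambda>n. D (s n) (T x)) \<longlonglongrightarrow> D x (T x)"
    unfolding D_def
    by (rule eta_continuous_dist_converges[OF cone P(2) metric cont _ x Tx])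
      (use sX lim in \<open>auto simp: D_def\<close>)
  have lim_step: "(\<lambda>n. D (s n) (s (Suc n))) \<longlonglongrightarrow> 0"
  proof (rule tendsto_sandwich[OF _ _ tendsto_const])
    show "(\<lambda>n. l ^ n * B) \<longlonglongrightarrow> 0"
      using tendsto_mult_right[OF LIMSEQ_power_zero[of l], of B] l by simp
  qed (auto simp: D_nonneg B)
  have "T x = x"
  proof -
    \<comment> \<open>A bound for all five distances between \<open>s n\<close>, \<open>x\<close> and their images that tends to
      \<open>D x (T x)\<close>.\<close>
    define M where "M n = max (D x (T x)) (D (s n) (T x))
      + (D (s n) x + D (s n) (s (Suc n)) + D (s (Suc n)) x)" for n
    have "D (s (Suc n)) (T x) \<le> l * M n" for n
      unfolding s_Suc
    proof (rule contr[OF sX x])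
      note nn = D_nonneg[of x "T x"] D_nonneg[of "s n" "T x"] D_nonneg[of "s n" x]
        D_nonneg[of "s n" "s (Suc n)"] D_nonneg[of "s (Suc n)" x]
      show "D (s n) x \<le> M n" "D (s n) (T (s n)) \<le> M n" "D x (T x) \<le> M n" "D (s n) (T x) \<le> M n"
        using nn unfolding M_def s_Suc by linarith+
      have "D x (T (s n)) = D (s (Suc n)) x" using D_sym[OF x sX[of "Suc n"]] by (simp add: s_Suc)
      then show "D x (T (s n)) \<le> M n"
        using nn unfolding M_def by linarith
    qed
    moreover have "(\<lambda>n. l * M n) \<longlonglongrightarrow> l * (max (D x (T x)) (D x (T x)) + (0 + 0 + 0))"
      unfolding M_def
      by (intro tendsto_intros tendsto_max lim_x lim_Tx lim_step LIMSEQ_Suc[OF lim_x])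
    ultimately have "D x (T x) \<le> l * (max (D x (T x)) (D x (T x)) + (0 + 0 + 0))"
      by (intro LIMSEQ_le[OF LIMSEQ_Suc[OF lim_Tx]]) auto
    then show ?thesis using D_zeroI[OF x Tx] by simp
  qed
  moreover have "y = x" if y: "y \<in> X" "T y = y" for y
  proof (rule D_zeroI[OF y(1) x])
    have "D y y = 0" "D x x = 0" using D_zero x y(1) by auto
    then have "D (T y) (T x) \<le> l * D y x"
      using y x \<open>T x = x\<close> D_nonneg[of y x] D_sym[OF x y(1)] by (intro contr) auto
    then show "D y x \<le> l * D y x" using y \<open>T x = x\<close> by simp
  qed
  ultimately show ?thesis using x by blast
qed

theorem theorem4p12:
  fixes P :: "'e::banach set" and K :: real
    and X :: "'a set" and \<eta> :: "'a \<Rightarrow> 'a \<Rightarrow> real"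
    and d :: "'a \<Rightarrow> 'a \<Rightarrow> 'e" and D :: "'a \<Rightarrow> 'a \<Rightarrow> real"
    and T :: "'a \<Rightarrow> 'a"
    and \<alpha> \<beta> \<gamma> \<delta> :: "'a \<Rightarrow> 'a \<Rightarrow> real"
    and l :: ereal
  assumes "normal_cone P" and "K = normal_constant P" and "interior P \<noteq> {}"
    and "eta_cone_metric P X \<eta> d"
    and "eta_continuous P X d"
    and "D = generated_dist d"
    and "dist_complete X D"
    and "T \<in> X \<rightarrow> X"
    and "\<And>x y. x \<in> X \<Longrightarrow> y \<in> X \<Longrightarrow>
           \<alpha> x y \<in> {0..<1} \<and> \<beta> x y \<in> {0..<1} \<and> \<gamma> x y \<in> {0..<1} \<and> \<delta> x y \<in> {0..<1}"
    and "\<And>x y. x \<in> X \<Longrightarrow> y \<in> X \<Longrightarrow>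
           D (T x) (T y) \<le> \<alpha> x y * D x y + \<beta> x y * D x (T x) + \<gamma> x y * D y (T y)
             + \<delta> x y * (D x (T y) + D y (T x))"
    and "l = (SUP (x, y)\<in>X \<times> X. ereal (\<alpha> x y + \<beta> x y + \<gamma> x y + 2 * \<eta> x y * \<delta> x y))"
    and "l < 1"
    and "(SUP (x, y)\<in>X \<times> X. ereal (\<eta> x y)) < 1 / l"
  shows "\<exists>!x. x \<in> X \<and> T x = x"
proof -
  have X: "X \<noteq> {}" and \<eta>1: "\<And>x y. \<lbrakk>x \<in> X; y \<in> X\<rbrakk> \<Longrightarrow> 1 \<le> \<eta> x y"
    using assms(4)[unfolded eta_cone_metric_def, THEN conjunct1] eta_cone_metricD(1)[OF assms(4)]
    by blast+
  have coeff: "0 \<le> \<alpha> x y" "0 \<le> \<beta> x y" "0 \<le> \<gamma> x y" "0 \<le> \<delta> x y" if "x \<in> X" "y \<in> X" for x y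
    using assms(9)[OF that] by auto
  have le_l: "ereal (\<alpha> x y + \<beta> x y + \<gamma> x y + 2 * \<eta> x y * \<delta> x y) \<le> l" if "x \<in> X" "y \<in> X" for x y
    unfolding assms(11) by (rule SUP_upper2[of "(x, y)"]) (use that in auto)
  obtain x0 where x0: "x0 \<in> X" using X by blast
  have "0 \<le> ereal (\<alpha> x0 x0 + \<beta> x0 x0 + \<gamma> x0 x0 + 2 * \<eta> x0 x0 * \<delta> x0 x0)"
    using coeff[OF x0 x0] \<eta>1[OF x0 x0] by simp
  then have "0 \<le> l" using le_l[OF x0 x0] by (rule order_trans)
  then obtain r where r: "l = ereal r" "0 \<le> r" "r < 1"
    using assms(12) by (cases l) auto
  define S where "S = (SUP (x, y)\<in>X \<times> X. ereal (\<eta> x y))"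
  have le_S: "ereal (\<eta> x y) \<le> S" if "x \<in> X" "y \<in> X" for x y
    unfolding S_def by (rule SUP_upper2[of "(x, y)"]) (use that in auto)
  \<comment> \<open>Even if \<open>1 / l\<close> is infinite, the strict inequality makes the supremum of \<open>\<eta>\<close> finite.\<close>
  have "S \<noteq> \<infinity>" using assms(13) by (auto simp: S_def)
  moreover have "S \<noteq> - \<infinity>" using le_S[OF x0 x0] by auto
  ultimately obtain S' where S': "S = ereal S'" by (cases S) auto
  show ?thesis
  proof (rule quasi_contraction_unique_fixed_point[of P X \<eta> d T S' r])
    show "\<eta> x y \<le> S'" if "x \<in> X" "y \<in> X" for x y
      using le_S[OF that] by (simp add: S')
    fix x y M
    assume xy: "x \<in> X" "y \<in> X"
      and M: "generated_dist d x y \<le> M" "generated_dist d x (T x) \<le> M"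
        "generated_dist d y (T y) \<le> M" "generated_dist d x (T y) \<le> M"
        "generated_dist d y (T x) \<le> M"
    have "0 \<le> M" using generated_dist_nonneg M(1) by (rule order_trans)
    moreover have "\<alpha> x y + \<beta> x y + \<gamma> x y + 2 * \<eta> x y * \<delta> x y \<le> r"
      using le_l[OF xy] by (simp add: r)
    ultimately show "generated_dist d (T x) (T y) \<le> r * M"
      using assms(10)[OF xy] weighted_distances_le[OF coeff[OF xy] \<eta>1[OF xy] _ _ M]
      unfolding assms(6) by (meson order_trans)
  qed (use assms r in auto)
qed

end
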